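(* The generalized Johnson graph $J(7,3,1)$ is a vertex-transitive CIS graph which is not localizable.
   Context: For integers $n>k>i\ge 0$, the generalized Johnson graph $J(n,k,i)$ has as vertices all $k$-element subsets of $\{1,\dots,n\}$, two vertices being adjacent iff their intersection has exactly $i$ elements. A clique is strong if it intersects every inclusion-maximal independent set. A graph is CIS if every inclusion-maximal clique is strong, and localizable if its vertex set can be partitioned into strong cliques. A graph is vertex-transitive if its automorphism group acts transitively on its vertices. *)

theory Defs
  imports "HOL-Library.Ramsey" "HOL-Library.Disjoint_Sets"
begin

text \<open>
  A finite simple graph is given by its vertex set and its set of edges, each edge being a
  two-element set of vertices, in accordance with the library predicates
  \<^const>\<open>clique\<close> and \<^const>\<open>indep\<close>. Those predicates do not require the set in question to
  consist of vertices, hence the conditions \<open>C \<subseteq> V\<close> below.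
\<close>

definition maximal_clique :: "'a set \<Rightarrow> 'a set set \<Rightarrow> 'a set \<Rightarrow> bool" where
  "maximal_clique V E C \<longleftrightarrow>
     C \<subseteq> V \<and> clique C E \<and> (\<forall>D. D \<subseteq> V \<and> clique D E \<and> C \<subseteq> D \<longrightarrow> D = C)"

definition maximal_indep :: "'a set \<Rightarrow> 'a set set \<Rightarrow> 'a set \<Rightarrow> bool" where
  "maximal_indep V E S \<longleftrightarrow>
     S \<subseteq> V \<and> indep S E \<and> (\<forall>T. T \<subseteq> V \<and> indep T E \<and> S \<subseteq> T \<longrightarrow> T = S)"

definition strong_clique :: "'a set \<Rightarrow> 'a set set \<Rightarrow> 'a set \<Rightarrow> bool" where
  "strong_clique V E C \<longleftrightarrow>
     C \<subseteq> V \<and> clique C E \<and> (\<forall>S. maximal_indep V E S \<longrightarrow> C \<inter> S \<noteq> {})"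

definition CIS_graph :: "'a set \<Rightarrow> 'a set set \<Rightarrow> bool" where
  "CIS_graph V E \<longleftrightarrow> (\<forall>C. maximal_clique V E C \<longrightarrow> strong_clique V E C)"

definition localizable :: "'a set \<Rightarrow> 'a set set \<Rightarrow> bool" where
  "localizable V E \<longleftrightarrow> (\<exists>P. partition_on V P \<and> (\<forall>C\<in>P. strong_clique V E C))"

definition graph_automorphism :: "'a set \<Rightarrow> 'a set set \<Rightarrow> ('a \<Rightarrow> 'a) \<Rightarrow> bool" where
  "graph_automorphism V E f \<longleftrightarrow>
     bij_betw f V V \<and> (\<forall>u\<in>V. \<forall>v\<in>V. {f u, f v} \<in> E \<longleftrightarrow> {u, v} \<in> E)"

definition vertex_transitive :: "'a set \<Rightarrow> 'a set set \<Rightarrow> bool" where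
  "vertex_transitive V E \<longleftrightarrow> (\<forall>u\<in>V. \<forall>v\<in>V. \<exists>f. graph_automorphism V E f \<and> f u = v)"

definition johnson_verts :: "nat \<Rightarrow> nat \<Rightarrow> nat set set" where
  "johnson_verts n k = nsets {1..n} k"

definition johnson_edges :: "nat \<Rightarrow> nat \<Rightarrow> nat \<Rightarrow> nat set set set" where
  "johnson_edges n k i =
     {{X, Y} | X Y. X \<in> johnson_verts n k \<and> Y \<in> johnson_verts n k \<and> X \<noteq> Y \<and> card (X \<inter> Y) = i}"

end

theory Submission
  imports Defs
begin

text \<open>
  An independent set of $J(7,3,1)$ consists of triples that pairwise share two points or none.
  Hence a maximal one either consists of the five triples through a pair of points, or of the four
  triples inside a four-point set together with the complementary triple. Up to a permutation of
  the points this leaves two maximal independent sets \<open>S\<close>. If a clique avoids \<open>S\<close> and no member of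
  \<open>S\<close> extends it, then it contains, for each of the five members of \<open>S\<close>, some non-neighbour of that
  member; a small backtracking search shows that this is impossible.

  In a partition into strong cliques each part contains exactly one triple \<open>{1, 2, x}\<close>, so the
  parts can be labelled by \<open>x \<in> {3..7}\<close>. The labels of \<open>{1, a, b}\<close> and of \<open>{2, a, b}\<close> then form two
  idempotent commutative Latin squares of order five on \<open>{3..7}\<close> that differ at every off-diagonal
  position, and there are no such squares, again by a small search.
\<close>

section \<open>Backtracking search for cliques\<close>

fun compatible :: "('a \<Rightarrow> 'a \<Rightarrow> bool) \<Rightarrow> 'a \<Rightarrow> 'a list \<Rightarrow> bool" where
  "compatible R x [] \<longleftrightarrow> True"
| "compatible R x (y # ys) \<longleftrightarrow> (if x = y \<or> R x y then compatible R x ys else False)"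

text \<open>
  The list \<open>acc\<close> holds the clique members chosen so far. The equations avoid bounded quantifiers
  since the code simplifier would unfold the search below the binder, with no pruning.
\<close>

fun no_clique_meets :: "('a \<Rightarrow> 'a \<Rightarrow> bool) \<Rightarrow> 'a list \<Rightarrow> 'a list list \<Rightarrow> bool" where
  "no_clique_meets R acc [] \<longleftrightarrow> False"
| "no_clique_meets R acc ([] # xss) \<longleftrightarrow> True"
| "no_clique_meets R acc ((x # xs) # xss) \<longleftrightarrow>
     (if compatible R x acc then no_clique_meets R (x # acc) xss else True) \<and>
     no_clique_meets R acc (xs # xss)"

lemma compatible_iff: "compatible R x ys \<longleftrightarrow> (\<forall>y\<in>set ys. x = y \<or> R x y)"
  by (induction ys) auto

text \<open>Follow the branch that picks a list head exactly when it lies in \<open>C\<close>. Its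
  picks are pairwise compatible, a repeated pick being harmless because \<open>compatible\<close>
  accepts \<open>x = y\<close>, so it is never pruned. A successful search can then end this branch
  only at a list exhausted without any pick, that is, one disjoint from \<open>C\<close>.\<close>

lemma no_clique_meets_sound:
  assumes "no_clique_meets R acc xss" "set acc \<subseteq> C" "\<And>x y. x \<in> C \<Longrightarrow> y \<in> C \<Longrightarrow> x \<noteq> y \<Longrightarrow> R x y"
  shows "\<exists>xs\<in>set xss. set xs \<inter> C = {}"
  using assms
proof (induction R acc xss rule: no_clique_meets.induct)
  case (3 R acc x xs xss)
  show ?case
  proof (cases "x \<in> C")
    case True
    then have "compatible R x acc" using 3 by (auto simp: compatible_iff)
    then show ?thesis using 3 True by auto
  next
    case False
    then show ?thesis using 3 by auto
  qed
qed auto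

section \<open>Vertices and adjacency of J(7,3,1)\<close>

definition meets_once :: "nat set \<Rightarrow> nat set \<Rightarrow> bool" where
  "meets_once X Y \<longleftrightarrow> card (X \<inter> Y) = 1"

definition triples :: "nat set list" where
  "triples = map set (filter (\<lambda>xs. length xs = 3) (subseqs [1..<8]))"

definition obstructions :: "nat set list \<Rightarrow> nat set list list" where
  "obstructions S = map (\<lambda>X. filter (\<lambda>T. T \<notin> set S \<and> \<not> meets_once X T) triples) S"

abbreviation V :: "nat set set" where "V \<equiv> johnson_verts 7 3"
abbreviation E :: "nat set set set" where "E \<equiv> johnson_edges 7 3 1"

lemma V_iff: "X \<in> V \<longleftrightarrow> X \<subseteq> {1..7} \<and> card X = 3"
  unfolding johnson_verts_def nsets_def using finite_subset[of X "{1..7}"] by auto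

lemma finite_V: "X \<in> V \<Longrightarrow> finite X"
  unfolding V_iff using finite_subset[of X "{1..7}"] by auto

lemma E_iff: "{X, Y} \<in> E \<longleftrightarrow> X \<in> V \<and> Y \<in> V \<and> X \<noteq> Y \<and> card (X \<inter> Y) = 1"
  unfolding johnson_edges_def by (auto simp: doubleton_eq_iff Int_commute)

lemma clique_iff:
  "C \<subseteq> V \<Longrightarrow> clique C E \<longleftrightarrow> (\<forall>X\<in>C. \<forall>Y\<in>C. X \<noteq> Y \<longrightarrow> card (X \<inter> Y) = 1)"
  unfolding clique_def E_iff by blast

lemma indep_iff:
  "S \<subseteq> V \<Longrightarrow> indep S E \<longleftrightarrow> (\<forall>X\<in>S. \<forall>Y\<in>S. X \<noteq> Y \<longrightarrow> card (X \<inter> Y) \<noteq> 1)"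
  unfolding indep_def E_iff by blast

lemma set_subseqs_length_eq:
  assumes "distinct xs"
  shows "set ` {ys \<in> set (subseqs xs). length ys = k} = {X. X \<subseteq> set xs \<and> card X = k}"
proof -
  have "length ys = card (set ys)" if "ys \<in> set (subseqs xs)" for ys
    using subseqs_distinctD[OF that assms] by (simp add: distinct_card)
  then have "set ` {ys \<in> set (subseqs xs). length ys = k} =
      {X \<in> set ` set (subseqs xs). card X = k}" by auto
  then show ?thesis by (auto simp: subseqs_powset)
qed

lemma set_triples: "set triples = V"
proof -
  have "set [1..<8] = {1..7::nat}" by auto
  then have "set triples = {X. X \<subseteq> {1..7} \<and> card X = 3}"
    using set_subseqs_length_eq[OF distinct_upt, of 1 8 3]
    unfolding triples_def set_map set_filter by (simp only:)
  then show ?thesis using V_iff by blast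
qed

subsection \<open>Symmetry\<close>

text \<open>Glue a bijection from \<open>A\<close> to \<open>B\<close> with one between the
  complements, which have equal size as well. This gives transitivity on triples, and later moves a
  pair or a four-point set to a standard position.\<close>

lemma bij_betw_mapping_subset:
  assumes "finite U" "A \<subseteq> U" "B \<subseteq> U" "card A = card B"
  obtains p where "bij_betw p U U" "p ` A = B"
proof -
  have fin: "finite A" "finite B" using assms finite_subset by auto
  then obtain f where f: "bij_betw f A B" using assms(4) finite_same_card_bij by blast
  have "card (U - A) = card (U - B)" using assms fin by (simp add: card_Diff_subset)
  then obtain g where g: "bij_betw g (U - A) (U - B)"
    using assms(1) finite_same_card_bij by blast
  let ?p = "\<lambda>x. if x \<in> A then f x else g x"
  have "bij_betw ?p A B" using f bij_betw_cong[of A ?p f B] by simp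
  moreover have "bij_betw ?p (U - A) (U - B)"
    using g bij_betw_cong[of "U - A" ?p g "U - B"] by simp
  ultimately have "bij_betw ?p (A \<union> (U - A)) (B \<union> (U - B))"
    by (intro bij_betw_combine) auto
  moreover have "A \<union> (U - A) = U" "B \<union> (U - B) = U" using assms by auto
  moreover have "?p ` A = B" using f by (auto simp: bij_betw_def)
  ultimately show ?thesis using that[of ?p] by simp
qed

lemma image_mem_V:
  assumes "bij_betw p {1..7} {1..7}" "X \<in> V"
  shows "p ` X \<in> V"
proof -
  have "inj_on p X" using assms by (meson V_iff bij_betw_def inj_on_subset)
  then show ?thesis using assms by (auto simp: V_iff card_image bij_betw_def)
qed

lemma card_image_Int_V:
  assumes "bij_betw p {1..7} {1..7}" "X \<in> V" "Y \<in> V"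
  shows "card (p ` X \<inter> p ` Y) = card (X \<inter> Y)"
proof -
  have inj: "inj_on p {1..7}" using assms bij_betw_def by blast
  have "p ` X \<inter> p ` Y = p ` (X \<inter> Y)"
    using inj_on_image_Int[OF inj] assms by (simp add: V_iff)
  moreover have "inj_on p (X \<inter> Y)" using inj assms by (meson V_iff inf.coboundedI1 inj_on_subset)
  ultimately show ?thesis by (simp add: card_image)
qed

lemma bij_betw_image_V:
  assumes "bij_betw p {1..7} {1..7}"
  shows "bij_betw ((`) p) V V"
proof -
  have "bij_betw ((`) p) (Pow {1..7}) (Pow {1..7})" using assms by (rule bij_betw_Pow)
  moreover have sub: "V \<subseteq> Pow {1..7}" using V_iff by blast
  ultimately have inj: "inj_on ((`) p) V" by (meson bij_betw_def inj_on_subset)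
  have "finite V" using sub by (rule finite_subset) simp
  then have "(`) p ` V = V" using inj image_mem_V[OF assms] by (intro endo_inj_surj) auto
  then show ?thesis using inj by (simp add: bij_betw_def)
qed

lemma graph_automorphism_image:
  assumes "bij_betw p {1..7} {1..7}"
  shows "graph_automorphism V E ((`) p)"
proof -
  have "p ` X = p ` Y \<longleftrightarrow> X = Y" if "X \<in> V" "Y \<in> V" for X Y
    using that bij_betw_image_V[OF assms] by (auto simp: bij_betw_def inj_on_def)
  then show ?thesis
    unfolding graph_automorphism_def E_iff
    using bij_betw_image_V[OF assms] image_mem_V[OF assms] card_image_Int_V[OF assms] by auto
qed

lemma vertex_transitive_J731: "vertex_transitive V E"
  unfolding vertex_transitive_def
proof (intro ballI)
  fix X Y assume "X \<in> V" "Y \<in> V"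
  then obtain p where "bij_betw p {1..7} {1..7}" "p ` X = Y"
    using bij_betw_mapping_subset[of "{1..7}" X Y] by (auto simp: V_iff)
  then show "\<exists>f. graph_automorphism V E f \<and> f X = Y"
    using graph_automorphism_image by blast
qed

subsection \<open>Maximal independent sets\<close>

definition through_pair :: "nat set \<Rightarrow> nat set set" where
  "through_pair P = {X \<in> V. P \<subseteq> X}"

definition split_by :: "nat set \<Rightarrow> nat set set" where
  "split_by Q = {X \<in> V. X \<subseteq> Q \<or> X \<inter> Q = {}}"

lemma through_pair_subset: "through_pair P \<subseteq> V"
  by (auto simp: through_pair_def)

lemma split_by_subset: "split_by Q \<subseteq> V"
  by (auto simp: split_by_def)

lemma V_eqI: "X \<in> V \<Longrightarrow> Y \<in> V \<Longrightarrow> X \<subseteq> Y \<Longrightarrow> X = Y"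
  by (metis V_iff card_subset_eq finite_V)

lemma card_Int_V_eq3D:
  assumes "X \<in> V" "Y \<in> V" "card (X \<inter> Y) = 3"
  shows "X = Y"
proof -
  have "X \<inter> Y = X"
    using card_subset_eq[OF finite_V[OF assms(1)], of "X \<inter> Y"] assms by (simp add: V_iff)
  then show ?thesis using assms V_eqI by blast
qed

lemma card_Int_V_le: "X \<in> V \<Longrightarrow> card (X \<inter> Y) \<le> 3"
  by (metis V_iff card_mono finite_V inf_le1)

lemma indep_through_pair:
  assumes "card P = 2"
  shows "indep (through_pair P) E"
  unfolding indep_iff[OF through_pair_subset]
proof (intro ballI impI)
  fix X Y assume "X \<in> through_pair P" "Y \<in> through_pair P"
  then have "P \<subseteq> X \<inter> Y" "finite (X \<inter> Y)" by (auto simp: through_pair_def finite_V)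
  then have "2 \<le> card (X \<inter> Y)" using assms by (metis card_mono)
  then show "card (X \<inter> Y) \<noteq> 1" by simp
qed

text \<open>Two triples inside \<open>Q\<close> have a union of at most four points, so they share
  at least two. A triple inside \<open>Q\<close> and one disjoint from \<open>Q\<close> share none.
  The only triple disjoint from \<open>Q\<close> is its complement.\<close>

lemma indep_split_by:
  assumes "Q \<subseteq> {1..7}" "card Q = 4"
  shows "indep (split_by Q) E"
  unfolding indep_iff[OF split_by_subset]
proof (intro ballI impI)
  fix X Y assume XY: "X \<in> split_by Q" "Y \<in> split_by Q" "X \<noteq> Y"
  then have V: "X \<in> V" "Y \<in> V" by (auto simp: split_by_def)
  have finQ: "finite Q" using assms finite_subset by blast
  consider "X \<subseteq> Q" "Y \<subseteq> Q" | "X \<inter> Y = {}" | "X \<inter> Q = {}" "Y \<inter> Q = {}"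
    using XY by (auto simp: split_by_def)
  then show "card (X \<inter> Y) \<noteq> 1"
  proof cases
    case 1
    then have "card (X \<union> Y) \<le> 4" using finQ assms by (metis Un_least card_mono)
    then show ?thesis using card_Un_Int[of X Y] V by (simp add: finite_V V_iff)
  next
    case 3
    have "{1..7} - Q \<in> V" using assms finQ by (simp add: V_iff card_Diff_subset)
    moreover have "X \<subseteq> {1..7} - Q" "Y \<subseteq> {1..7} - Q" using 3 V V_iff by blast+
    ultimately have "X = Y" using V V_eqI by metis
    then show ?thesis using XY by simp
  qed simp
qed

text \<open>If \<open>S\<close> contains disjoint triples \<open>A\<close> and \<open>B\<close>, a
  single point \<open>g\<close> remains, and adding it to \<open>A\<close> or to \<open>B\<close>
  gives the four-point set. Otherwise any two members share at least two points, so they either have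
  a common pair or all lie in the union of two of them.\<close>

lemma indep_cases:
  assumes SV: "S \<subseteq> V" and S: "indep S E"
  obtains P where "P \<subseteq> {1..7}" "card P = 2" "S \<subseteq> through_pair P"
  | Q where "Q \<subseteq> {1..7}" "card Q = 4" "S \<subseteq> split_by Q"
proof -
  have ne1: "card (X \<inter> Y) \<noteq> 1" if "X \<in> S" "Y \<in> S" for X Y
  proof (cases "X = Y")
    case True
    then show ?thesis using that SV by (auto simp: V_iff)
  qed (use that S indep_iff[OF SV] in blast)
  show ?thesis
  proof (cases "\<exists>A\<in>S. \<exists>B\<in>S. A \<inter> B = {}")
    case True
    then obtain A B where AB: "A \<in> S" "B \<in> S" "A \<inter> B = {}" by blast
    then have V: "A \<in> V" "B \<in> V" using SV by auto
    have "card (A \<union> B) = 6" using AB V by (simp add: card_Un_disjoint finite_V V_iff)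
    moreover have sub: "A \<union> B \<subseteq> {1..7}" using V by (auto simp: V_iff)
    ultimately have "card ({1..7} - (A \<union> B)) = 1"
      using V by (simp add: card_Diff_subset finite_V)
    then obtain g where g: "{1..7} - (A \<union> B) = {g}" using card_1_singletonE by blast
    have cardT: "card (T \<inter> A) + card (T \<inter> B) + card (T \<inter> {g}) = 3" if "T \<in> S" for T
    proof -
      have T: "T \<subseteq> {1..7}" "card T = 3" "finite T" using that SV finite_V V_iff by auto
      have "card ((T \<inter> A) \<union> (T \<inter> B)) = card (T \<inter> A) + card (T \<inter> B)"
        using AB T by (intro card_Un_disjoint) auto
      moreover have "card ((T \<inter> A) \<union> (T \<inter> B) \<union> (T \<inter> {g})) =
          card ((T \<inter> A) \<union> (T \<inter> B)) + card (T \<inter> {g})"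
        using g T by (intro card_Un_disjoint) auto
      moreover have "(T \<inter> A) \<union> (T \<inter> B) \<union> (T \<inter> {g}) = T" using T g by blast
      ultimately show ?thesis using T by simp
    qed
    \<comment> \<open>The three summands in \<open>cardT\<close> can only be (3,0,0), (0,3,0),
      (2,0,1) or (0,2,1), since the first two differ from 1 and the last is at most 1.\<close>
    have member: "T = A \<or> T = B \<or> g \<in> T \<and> (T \<inter> A = {} \<or> T \<inter> B = {})" if "T \<in> S" for T
    proof -
      have TV: "T \<in> V" using that SV by auto
      have "card (T \<inter> A) \<noteq> 1" "card (T \<inter> B) \<noteq> 1" using ne1 that AB by auto
      moreover have "card (T \<inter> {g}) \<le> 1" using card_mono[of "{g}" "T \<inter> {g}"] by simp
      moreover have "T = A" if "card (T \<inter> A) = 3" using that TV V card_Int_V_eq3D by auto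
      moreover have "T = B" if "card (T \<inter> B) = 3" using that TV V card_Int_V_eq3D by auto
      moreover have "g \<in> T" if "card (T \<inter> {g}) \<noteq> 0" using that by auto
      moreover have "T \<inter> A = {}" if "card (T \<inter> A) = 0" using that TV finite_V by auto
      moreover have "T \<inter> B = {}" if "card (T \<inter> B) = 0" using that TV finite_V by auto
      ultimately show ?thesis using cardT[OF that] by linarith
    qed
    have g': "g \<notin> A" "g \<notin> B" "g \<in> {1..7}" using g by auto
    have one: "S \<subseteq> split_by (insert g A) \<or> S \<subseteq> split_by (insert g B)"
    proof (rule ccontr)
      \<comment> \<open>A violator \<open>X\<close> of the first inclusion contains \<open>g\<close>
        and misses \<open>A\<close>, a violator \<open>Y\<close> of the second contains
        \<open>g\<close> and misses \<open>B\<close>. They would meet exactly in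
        \<open>g\<close>.\<close>
      assume "\<not> ?thesis"
      then obtain X Y where XY: "X \<in> S" "X \<notin> split_by (insert g A)"
        "Y \<in> S" "Y \<notin> split_by (insert g B)" by blast
      then have "X \<in> V" "Y \<in> V" using SV by auto
      moreover from this have "X \<subseteq> insert g (A \<union> B)" "Y \<subseteq> insert g (A \<union> B)"
        using V_iff g by blast+
      ultimately have sub: "X \<subseteq> insert g (A \<union> B)" "Y \<subseteq> insert g (A \<union> B)" "X \<in> V" "Y \<in> V"
        by auto
      have "\<not> X \<subseteq> insert g A" "X \<inter> insert g A \<noteq> {}"
        using XY(2) sub(3) unfolding split_by_def by blast+
      then have "g \<in> X \<and> X \<inter> A = {}" using sub(1) AB(3) g' member[OF XY(1)] by blast
      moreover have "\<not> Y \<subseteq> insert g B" "Y \<inter> insert g B \<noteq> {}"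
        using XY(4) sub(4) unfolding split_by_def by blast+
      then have "g \<in> Y \<and> Y \<inter> B = {}" using sub(2) AB(3) g' member[OF XY(3)] by blast
      ultimately have "X \<inter> Y = {g}" using sub by blast
      then show False using ne1[OF XY(1,3)] by simp
    qed
    have "insert g A \<subseteq> {1..7}" "card (insert g A) = 4" "insert g B \<subseteq> {1..7}" "card (insert g B) = 4"
      using V g' by (auto simp: finite_V V_iff)
    then show ?thesis using one that by blast
  next
    case False
    have ge2: "2 \<le> card (X \<inter> Y)" if "X \<in> S" "Y \<in> S" for X Y
    proof -
      have "finite (X \<inter> Y)" "X \<inter> Y \<noteq> {}" using that SV finite_V False by auto
      then have "card (X \<inter> Y) \<noteq> 0" by simp
      then show ?thesis using ne1[OF that] by linarith
    qed
    consider "S = {}" | A where "S = {A}" | A B where "A \<in> S" "B \<in> S" "A \<noteq> B" by blast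
    then show ?thesis
    proof cases
      case 1
      \<comment> \<open>Any pair serves here.\<close>
      then show ?thesis using that(1)[of "{1, 2}"] by simp
    next
      case (2 A)
      then have A: "A \<in> V" using SV by auto
      then have "2 \<le> card A" by (simp add: V_iff)
      then obtain P where "P \<subseteq> A" "card P = 2" by (meson obtain_subset_with_card_n)
      then show ?thesis using that(1)[of P] 2 A by (auto simp: through_pair_def V_iff)
    next
      case (3 A B)
      then have V: "A \<in> V" "B \<in> V" using SV by auto
      have "card (A \<inter> B) \<noteq> 3" using 3 V card_Int_V_eq3D by blast
      then have AB: "card (A \<inter> B) = 2"
        using ge2[OF 3(1,2)] card_Int_V_le[OF V(1), of B] by linarith
      have Un: "card (A \<union> B) = 4" using card_Un_Int[of A B] AB V by (simp add: finite_V V_iff)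
      \<comment> \<open>A triple leaving the four-point set has at most two points inside it, but at
        least two in \<open>A\<close> and two in \<open>B\<close>. These are the same two points,
        hence the pair shared by \<open>A\<close> and \<open>B\<close>.\<close>
      have through: "X \<inter> (A \<union> B) = A \<inter> B" if X: "X \<in> S" "\<not> X \<subseteq> A \<union> B" for X
      proof -
        have fin: "finite X" and X3: "card X = 3" using X SV finite_V V_iff by auto
        have "X \<inter> (A \<union> B) \<subset> X" using X by blast
        then have "card (X \<inter> (A \<union> B)) < 3" using fin X3 psubset_card_mono by metis
        moreover have "2 \<le> card (X \<inter> A)" "2 \<le> card (X \<inter> B)" using ge2 X 3 by auto
        ultimately have "X \<inter> A = X \<inter> (A \<union> B)" "X \<inter> B = X \<inter> (A \<union> B)"
          using fin by (intro card_seteq; (linarith | blast | simp))+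
        then have sub: "X \<inter> (A \<union> B) \<subseteq> A \<inter> B" by blast
        have "2 \<le> card (X \<inter> (A \<union> B))"
          using \<open>2 \<le> card (X \<inter> A)\<close> \<open>X \<inter> A = X \<inter> (A \<union> B)\<close> by simp
        then show ?thesis using sub AB V finite_V by (intro card_seteq) auto
      qed
      show ?thesis
      proof (cases "S \<subseteq> through_pair (A \<inter> B)")
        case True
        then show ?thesis using that(1)[of "A \<inter> B"] AB V by (auto simp: V_iff)
      next
        case False
        then obtain T where T: "T \<in> S" "\<not> A \<inter> B \<subseteq> T" using SV by (auto simp: through_pair_def)
        then have TQ: "T \<subseteq> A \<union> B" using through by blast
        \<comment> \<open>If \<open>X\<close> left the four-point set, it could share with
          \<open>T\<close> only points of the pair. Sharing two points would then force
          \<open>T\<close> to contain the pair.\<close>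
        have "X \<subseteq> A \<union> B" if X: "X \<in> S" for X
        proof (rule ccontr)
          assume "\<not> X \<subseteq> A \<union> B"
          then have "X \<inter> T \<subseteq> A \<inter> B" using through X TQ by blast
          then have "X \<inter> T = A \<inter> B"
            using ge2[OF X T(1)] AB V finite_V by (intro card_seteq) auto
          then show False using T by blast
        qed
        then have "S \<subseteq> split_by (A \<union> B)" using SV unfolding split_by_def by blast
        moreover have "A \<union> B \<subseteq> {1..7}" using V V_iff by blast
        ultimately show ?thesis using that(2) Un by blast
      qed
    qed
  qed
qed

subsection \<open>The CIS property\<close>

text \<open>The permutation \<open>p\<close> carries the clique to the standard position, where the
  search has been run for \<open>S\<close>. Were \<open>C\<close> disjoint from \<open>M\<close>,
  the search would yield a member of \<open>S\<close> with no obstruction in the image of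
  \<open>C\<close>. Its preimage \<open>Z\<close> lies in \<open>M\<close> and is adjacent to all of
  \<open>C\<close>, so maximality puts \<open>Z\<close> into \<open>C\<close>.\<close>

lemma maximal_clique_meets:
  assumes p: "bij_betw p {1..7} {1..7}"
    and C: "maximal_clique V E C"
    and search: "no_clique_meets meets_once [] (obstructions S)"
    and S: "set S \<subseteq> V" "\<And>X. X \<in> V \<Longrightarrow> p ` X \<in> set S \<Longrightarrow> X \<in> M"
  shows "C \<inter> M \<noteq> {}"
proof
  assume disj: "C \<inter> M = {}"
  have CV: "C \<subseteq> V" and clique: "clique C E" using C by (auto simp: maximal_clique_def)
  have pairwise: "card (X \<inter> Y) = 1" if "X \<in> C" "Y \<in> C" "X \<noteq> Y" for X Y
    using that clique clique_iff[OF CV] by blast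
  have image_pairwise: "meets_once X Y"
    if XY: "X \<in> (`) p ` C" "Y \<in> (`) p ` C" "X \<noteq> Y" for X Y
  proof -
    obtain X' Y' where XY': "X' \<in> C" "Y' \<in> C" "X = p ` X'" "Y = p ` Y'" "X' \<noteq> Y'"
      using XY by blast
    then have "card (X \<inter> Y) = card (X' \<inter> Y')" using card_image_Int_V[OF p] CV by blast
    then show ?thesis using pairwise[OF XY'(1,2,5)] by (simp add: meets_once_def)
  qed
  have "\<exists>xs\<in>set (obstructions S). set xs \<inter> (`) p ` C = {}"
    by (rule no_clique_meets_sound[OF search _ image_pairwise]) simp_all
  then obtain X where X: "X \<in> set S"
    and obs: "{T \<in> V. T \<notin> set S \<and> card (X \<inter> T) \<noteq> 1} \<inter> (`) p ` C = {}"
    unfolding obstructions_def meets_once_def set_map set_filter set_triples bex_simps by blast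
  obtain Z where Z: "Z \<in> V" "X = p ` Z"
    using X S(1) bij_betw_imp_surj_on[OF bij_betw_image_V[OF p]] by blast
  then have "Z \<in> M" using X S(2)[of Z] by simp
  have "card (Z \<inter> T) = 1" if "T \<in> C" for T
  proof -
    have "p ` T \<notin> set S" "p ` T \<in> V" using that disj S(2) CV image_mem_V[OF p] by blast+
    then have "card (p ` Z \<inter> p ` T) = 1" using obs that Z by blast
    then show ?thesis using card_image_Int_V[OF p Z(1), of T] that CV by auto
  qed
  then have "card (X \<inter> Y) = 1" if "X \<in> insert Z C" "Y \<in> insert Z C" "X \<noteq> Y" for X Y
    using that pairwise by (metis Int_commute insertE)
  then have "clique (insert Z C) E" using clique_iff[of "insert Z C"] Z(1) CV by blast
  then have "Z \<in> C" using C Z CV unfolding maximal_clique_def by blast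
  then show False using disj \<open>Z \<in> M\<close> by blast
qed

lemma CIS_J731: "CIS_graph V E"
  unfolding CIS_graph_def
proof (intro allI impI)
  fix C assume C: "maximal_clique V E C"
  have "C \<inter> S \<noteq> {}" if S: "maximal_indep V E S" for S
  proof -
    have max: "S = T" if "T \<subseteq> V" "indep T E" "S \<subseteq> T" for T
      using S that by (auto simp: maximal_indep_def)
    have "S \<subseteq> V" "indep S E" using S by (auto simp: maximal_indep_def)
    then show ?thesis
    proof (cases rule: indep_cases)
      case (1 P)
      \<comment> \<open>Maximality turns the inclusion from \<open>indep_cases\<close> into an
        equality, as the larger set is independent too.\<close>
      then have "S = through_pair P" using max through_pair_subset indep_through_pair by blast
      obtain p :: "nat \<Rightarrow> nat" where p: "bij_betw p {1..7} {1..7}" "p ` P = {1, 2}"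
        using bij_betw_mapping_subset[of "{1..7}" P "{1, 2}"] 1 by auto
      have mem: "X \<in> through_pair P"
        if "X \<in> V" "p ` X \<in> set [{1, 2, 3}, {1, 2, 4}, {1, 2, 5}, {1, 2, 6}, {1, 2, 7}]" for X
      proof -
        have "p ` P \<subseteq> p ` X" using that(2) unfolding p(2) by auto
        moreover have "X \<subseteq> {1..7}" using that(1) V_iff by blast
        ultimately have "P \<subseteq> X" using bij_betw_imp_inj_on[OF p(1)] 1(1) unfolding inj_on_def by blast
        then show ?thesis using that by (simp add: through_pair_def)
      qed
      have search: "no_clique_meets meets_once []
          (obstructions [{1, 2, 3}, {1, 2, 4}, {1, 2, 5}, {1, 2, 6}, {1, 2, 7}])"
        by code_simp
      have "set [{1, 2, 3}, {1, 2, 4}, {1, 2, 5}, {1, 2, 6}, {1, 2, 7}] \<subseteq> V"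
        by (simp add: V_iff)
      then show ?thesis
        using maximal_clique_meets[OF p(1) C search _ mem] unfolding \<open>S = through_pair P\<close> by blast
    next
      case (2 Q)
      then have "S = split_by Q" using max split_by_subset indep_split_by by blast
      obtain p :: "nat \<Rightarrow> nat" where p: "bij_betw p {1..7} {1..7}" "p ` Q = {1, 2, 3, 4}"
        using bij_betw_mapping_subset[of "{1..7}" Q "{1, 2, 3, 4}"] 2 by auto
      have mem: "X \<in> split_by Q"
        if "X \<in> V" "p ` X \<in> set [{1, 2, 3}, {1, 2, 4}, {1, 3, 4}, {2, 3, 4}, {5, 6, 7}]" for X
      proof -
        have "Y \<subseteq> {1, 2, 3, 4} \<or> Y \<inter> {1, 2, 3, 4} = {}"
          if "Y \<in> set [{1, 2, 3}, {1, 2, 4}, {1, 3, 4}, {2, 3, 4}, {5, 6, 7}]" for Y :: "nat set"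
          using that by auto
        then have "p ` X \<subseteq> p ` Q \<or> p ` X \<inter> p ` Q = {}" using that(2) unfolding p(2) .
        moreover have "X \<subseteq> {1..7}" using that(1) V_iff by blast
        ultimately have "X \<subseteq> Q \<or> X \<inter> Q = {}"
          using bij_betw_imp_inj_on[OF p(1)] 2(1) unfolding inj_on_def by blast
        then show ?thesis using that by (simp add: split_by_def)
      qed
      have search: "no_clique_meets meets_once []
          (obstructions [{1, 2, 3}, {1, 2, 4}, {1, 3, 4}, {2, 3, 4}, {5, 6, 7}])"
        by code_simp
      have "set [{1, 2, 3}, {1, 2, 4}, {1, 3, 4}, {2, 3, 4}, {5, 6, 7}] \<subseteq> V"
        by (simp add: V_iff)
      then show ?thesis
        using maximal_clique_meets[OF p(1) C search _ mem] unfolding \<open>S = split_by Q\<close> by blast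
    qed
  qed
  then show "strong_clique V E C" using C by (auto simp: strong_clique_def maximal_clique_def)
qed

subsection \<open>Non-localizability\<close>

text \<open>A triple not containing both 1 and 2 meets some \<open>{1, 2, i}\<close> in exactly one
  point: take \<open>i\<close> outside it if it contains 1 or 2, and inside it otherwise. The proof
  checks this by enumeration. Every strong clique therefore contains some
  \<open>{1, 2, i}\<close>.\<close>

lemma maximal_indep_through_12: "maximal_indep V E (through_pair {1, 2})"
  unfolding maximal_indep_def
proof (intro conjI allI impI)
  fix T assume T: "T \<subseteq> V \<and> indep T E \<and> through_pair {1, 2} \<subseteq> T"
  have all: "\<forall>X\<in>set triples. {1, 2} \<subseteq> X \<or> (\<exists>Y\<in>set triples. {1, 2} \<subseteq> Y \<and> card (X \<inter> Y) = 1)"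
    by code_simp
  have "X \<in> through_pair {1, 2}" if X: "X \<in> T" for X
  proof (rule ccontr)
    assume X': "X \<notin> through_pair {1, 2}"
    have "X \<in> V" using X T by blast
    then have "\<not> {1, 2} \<subseteq> X" using X' unfolding through_pair_def by blast
    then obtain Y where Y: "Y \<in> V" "{1, 2} \<subseteq> Y" "card (X \<inter> Y) = 1"
      using all \<open>X \<in> V\<close> unfolding set_triples by meson
    then have "Y \<in> T" using T unfolding through_pair_def by blast
    moreover have "X \<noteq> Y" using Y(2) \<open>\<not> {1, 2} \<subseteq> X\<close> by metis
    ultimately show False using X Y(3) T indep_iff[of T] by blast
  qed
  then have "T \<subseteq> through_pair {1, 2}" by (rule subsetI)
  then show "T = through_pair {1, 2}" using T by (intro subset_antisym) simp_all
qed (rule through_pair_subset, rule indep_through_pair, simp)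

lemma insert_12_mem_V: "i \<in> {3..7} \<Longrightarrow> {1, 2, i} \<in> V"
  by (auto simp: V_iff)

lemma through_12E:
  assumes "X \<in> through_pair {1, 2}"
  obtains i where "i \<in> {3..7}" "X = {1, 2, i}"
proof -
  have XV: "X \<in> V" and sub: "{1, 2} \<subseteq> X" using assms unfolding through_pair_def by blast+
  have "card {1, 2::nat} = 2" "card X = 3" using XV by (simp_all add: V_iff)
  then have "card (X - {1, 2}) = 1" using sub card_Diff_subset[of "{1, 2}" X] by simp
  then obtain i where i: "X - {1, 2} = {i}" using card_1_singletonE by blast
  then have "i \<in> {1..7}" "i \<noteq> 1" "i \<noteq> 2" using XV V_iff by blast+
  then have "i \<in> {3..7}" by auto
  moreover have "X = {1, 2, i}" using i sub by blast
  ultimately show thesis using that by blast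
qed

text \<open>Equal labels mean a common part and thus force adjacency; different labels impose
  nothing. A labelling, seen as a set of pairs, becomes a clique for this relation, so the same
  search applies.\<close>

definition label_compatible :: "nat set \<times> nat \<Rightarrow> nat set \<times> nat \<Rightarrow> bool" where
  "label_compatible x y \<longleftrightarrow> (if snd x = snd y then meets_once (fst x) (fst y) else True)"

lemma not_localizable_J731: "\<not> localizable V E"
proof
  assume "localizable V E"
  then obtain P where P: "partition_on V P" "\<And>C. C \<in> P \<Longrightarrow> strong_clique V E C"
    by (auto simp: localizable_def)
  have pairwise: "card (X \<inter> Y) = 1" if "C \<in> P" "X \<in> C" "Y \<in> C" "X \<noteq> Y" for C X Y
    using that P(2)[OF that(1)] clique_iff[of C] unfolding strong_clique_def by blast
  have part_eq: "C = D" if "C \<in> P" "D \<in> P" "X \<in> C" "X \<in> D" for C D X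
    using that partition_onD2[OF P(1)] by (auto simp: disjoint_def)
  have "\<exists>i. i \<in> {3..7} \<and> (\<exists>C\<in>P. X \<in> C \<and> {1, 2, i} \<in> C)" if X: "X \<in> V" for X
  proof -
    obtain C where C: "C \<in> P" "X \<in> C" using X partition_onD1[OF P(1)] by blast
    then have "C \<inter> through_pair {1, 2} \<noteq> {}"
      using P(2) maximal_indep_through_12 by (auto simp: strong_clique_def)
    then obtain i where "i \<in> {3..7}" "{1, 2, i} \<in> C" using through_12E by blast
    then show ?thesis using C by blast
  qed
  then obtain c where c: "\<And>X. X \<in> V \<Longrightarrow> c X \<in> {3..7} \<and> (\<exists>C\<in>P. X \<in> C \<and> {1, 2, c X} \<in> C)"
    by metis
  \<comment> \<open>Equal labels \<open>i\<close> put both triples into the part containing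
    \<open>{1, 2, i}\<close>.\<close>
  have same: "card (X \<inter> Y) = 1" if XY: "X \<in> V" "Y \<in> V" "c X = c Y" "X \<noteq> Y" for X Y
  proof -
    obtain C where C: "C \<in> P" "X \<in> C" "{1, 2, c X} \<in> C" using c[OF XY(1)] by blast
    obtain D where D: "D \<in> P" "Y \<in> D" "{1, 2, c X} \<in> D" using c[OF XY(2)] XY(3) by auto
    have "C = D" using part_eq[OF C(1) D(1) C(3) D(3)] .
    then show ?thesis using pairwise C D XY by blast
  qed
  \<comment> \<open>Two different triples through 1 and 2 share two points, so they never lie in one
    part.\<close>
  have c12: "c {1, 2, i} = i" if i: "i \<in> {3..7}" for i
  proof (rule ccontr)
    assume ne: "c {1, 2, i} \<noteq> i"
    have "{1, 2, i} \<in> V" using insert_12_mem_V[OF i] .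
    then obtain C where C: "C \<in> P" "{1, 2, i} \<in> C" "{1, 2, c {1, 2, i}} \<in> C" using c by blast
    have "c {1, 2, i} \<in> {3..7}" using c \<open>{1, 2, i} \<in> V\<close> by blast
    then have "{1, 2, i} \<inter> {1, 2, c {1, 2, i}} = {1, 2}" "i \<notin> {1, 2, c {1, 2, i}}"
      using ne i by auto
    moreover from this(2) have "{1, 2, i} \<noteq> {1, 2, c {1, 2, i}}" by blast
    ultimately show False using pairwise[OF C] by simp
  qed
  \<comment> \<open>The search starts from the known labels of the triples \<open>{1, 2, i}\<close>.
    They exclude the labels \<open>a\<close> and \<open>b\<close> for \<open>{d, a, b}\<close>,
    which is the idempotence of the squares. Each list in \<open>?xss\<close> offers all five labels
    for one triple.\<close>
  let ?acc = "map (\<lambda>i. ({1, 2, i}, i)) [3..<8]"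
  let ?xs = "\<lambda>d a b. map (\<lambda>i. ({d, a, b}, i)) [3..<8]"
  let ?xss = "[?xs d a b. d \<leftarrow> [1, 2], a \<leftarrow> [3..<8], b \<leftarrow> [a+1..<8]]"
  let ?C = "(\<lambda>X. (X, c X)) ` V"
  have search: "no_clique_meets label_compatible ?acc ?xss" by code_simp
  have meets: "\<exists>xs\<in>set ?xss. set xs \<inter> ?C = {}"
  proof (rule no_clique_meets_sound[OF search])
    show "set ?acc \<subseteq> ?C"
    proof
      fix x assume "x \<in> set ?acc"
      then obtain i where i: "i \<in> {3..<8}" "x = ({1, 2, i}, i)" unfolding set_map set_upt by blast
      then have "i \<in> {3..7}" by simp
      then have "{1, 2, i} \<in> V" "c {1, 2, i} = i" using insert_12_mem_V c12 by blast+
      then show "x \<in> ?C" unfolding i(2) by (intro image_eqI[where x = "{1, 2, i}"]) simp_all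
    qed
  next
    fix x y assume "x \<in> ?C" "y \<in> ?C" "x \<noteq> y"
    then obtain X Y where "x = (X, c X)" "y = (Y, c Y)" "X \<in> V" "Y \<in> V" "X \<noteq> Y" by blast
    then show "label_compatible x y"
      using same[of X Y] by (simp add: label_compatible_def meets_once_def)
  qed
  have mem: "\<exists>d\<in>set ds. \<exists>a\<in>set as. \<exists>b\<in>set (bs a). xs = g d a b"
    if "xs \<in> set [g d a b. d \<leftarrow> ds, a \<leftarrow> as, b \<leftarrow> bs a]"
    for xs and g :: "nat \<Rightarrow> nat \<Rightarrow> nat \<Rightarrow> (nat set \<times> nat) list" and ds as bs
    using that by auto
  obtain xs where xs: "xs \<in> set ?xss" "set xs \<inter> ?C = {}"
    using meets by (rule bexE)
  obtain d a b where dab: "d \<in> set [1, 2]" "a \<in> set [3..<8]" "b \<in> set [a+1..<8]"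
    and "xs = ?xs d a b"
    using mem[OF xs(1)] by (elim bexE)
  then have disj: "set (?xs d a b) \<inter> ?C = {}" using xs(2) by (simp only:)
  have "d \<in> {1, 2}" "a \<in> {3..7}" "b \<in> {a+1..7}" using dab unfolding set_upt by auto
  then have V: "{d, a, b} \<in> V" by (auto simp: V_iff)
  \<comment> \<open>The list of \<open>{d, a, b}\<close> contains its actual label, so it cannot be
    disjoint from \<open>?C\<close>.\<close>
  then have "c {d, a, b} \<in> set [3..<8]" using c unfolding set_upt by fastforce
  then have "({d, a, b}, c {d, a, b}) \<in> set (?xs d a b) \<inter> ?C" using V unfolding set_map by blast
  then show False unfolding disj by blast
qed

theorem theorem4p3:
  shows "vertex_transitive (johnson_verts 7 3) (johnson_edges 7 3 1) \<and>
         CIS_graph (johnson_verts 7 3) (johnson_edges 7 3 1) \<and>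
         \<not> localizable (johnson_verts 7 3) (johnson_edges 7 3 1)"
  using vertex_transitive_J731 CIS_J731 not_localizable_J731 by blast

end
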